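(* Let $y_0\in\mathbb{R}^m$, and let $(x_k)$ be the sequence generated by the ARBK method (defined in the context) started at $x_0^*=\mathbf{A}^\top y_0$, where the parameter sequence is set to be constant, $\theta_k=\theta_0=\frac1m$ for all $k$. Then for all $k\ge 1$ it holds $$\frac12\,\mathbb{E}\big[\|x_k-\hat x\|_2^2\big]\le\mathbb{E}\big[D_f^{x_k^*}(x_k,\hat x)\big]\le\frac{2\|\mathbf{A}\|_F^2}{k+4}\,R_0^2(y_0),$$ where $$R_0(y_0)=\max_{y\in\mathbb{R}^m}\Big\{\min_{\hat y\in\mathcal{Y}^*}\|y-\hat y\|_2:\ \Psi(y)\le\Psi(y_0)\Big\}.$$
   Context: $\mathbf{A}\in\mathbb{R}^{m\times n}$ is a matrix with rows $a_i^\top$, $a_i\neq 0$ for all $i\in\{1,\dots,m\}$, $\|\mathbf{A}\|_F$ is its Frobenius norm, and $b\in\mathbb{R}^m$ is such that $\mathbf{A}x=b$ is consistent. The function $f:\mathbb{R}^n\to\mathbb{R}$ (finite everywhere, not necessarily smooth) is $1$-strongly convex: for all $x,y\in\mathbb{R}^n$ and all subgradients $x^*\in\partial f(x)$, $f(y)\ge f(x)+\langle x^*,y-x\rangle+\frac12\|y-x\|_2^2$. Its Fenchel conjugate is $f^*(x^* )=\sup_{y\in\mathbb{R}^n}\langle x^*,y\rangle-f(y)$, which is finite everywhere, convex and differentiable with Lipschitz continuous gradient. The vector $\hat x$ is the unique solution of $\min_{x\in\mathbb{R}^n} f(x)$ subject to $\mathbf{A}x=b$. The dual function is $\Psi(y)=f^*(\mathbf{A}^\top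 y)-b^\top y$ for $y\in\mathbb{R}^m$, $\Psi^*=\min_{y\in\mathbb{R}^m}\Psi(y)$, and $\mathcal{Y}^*\neq\emptyset$ is the set of minimizers of $\Psi$. For $x,y\in\mathbb{R}^n$ and $x^*\in\partial f(x)$, the Bregman distance is $D_f^{x^*}(x,y)=f(y)-f(x)-\langle x^*,y-x\rangle$ (note that $x=\nabla f^*(x^* )$ is equivalent to $x^*\in\partial f(x)$). ARBK method (Accelerated Randomized Bregman-Kaczmarz) with parameter sequence $(\theta_k)$: choose $x_0^*$ and set $t_0=x_0^*$. For $k=0,1,2,\dots$: (1) $c_k=(1-\theta_k)x_k^*+\theta_k t_k$; (2) choose a random row index $i_k\in\{1,\dots,m\}$, independently of the previous choices, with $P(i_k=i)=\|a_i\|_2^2/\|\mathbf{A}\|_F^2$; (3) $t_{k+1}=t_k-\frac{1}{m\theta_k\|a_{i_k}\|_2^2}\big(a_{i_k}^\top\nabla f^*(c_k)-b_{i_k}\big)a_{i_k}$; (4) $x_{k+1}^*=c_k+m\theta_k(t_{k+1}-t_k)$. The iterates are $x_k=\nabla f^*(x_k^* )$. The expectation $\mathbb{E}$ is with respect to the random choices of the indices. *)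

theory Defs
  imports "HOL-Probability.Probability"
begin

definition subdifferential :: "('a::real_inner \<Rightarrow> real) \<Rightarrow> 'a \<Rightarrow> 'a set" where
  "subdifferential f x = {g. \<forall>y. f y \<ge> f x + g \<bullet> (y - x)}"

text \<open>The subgradient inequality alone would hold vacuously for a function without
  subgradients, so convexity is part of the definition.\<close>

definition strongly_convex1 :: "('a::real_inner \<Rightarrow> real) \<Rightarrow> bool" where
  "strongly_convex1 f \<longleftrightarrow> convex_on UNIV f \<and>
     (\<forall>x y. \<forall>g \<in> subdifferential f x. f y \<ge> f x + g \<bullet> (y - x) + 1/2 * (norm (y - x))\<^sup>2)"

text \<open>The supremum is taken in the reals: for a finite \<open>1\<close>-strongly convex \<open>f\<close> on a
  Euclidean space the set is bounded above, so the conjugate is finite everywhere.\<close>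

definition conjugate :: "('a::real_inner \<Rightarrow> real) \<Rightarrow> 'a \<Rightarrow> real" where
  "conjugate f g = (SUP y. g \<bullet> y - f y)"

definition gradient :: "('a::real_inner \<Rightarrow> real) \<Rightarrow> 'a \<Rightarrow> 'a" where
  "gradient h x = (THE D. GDERIV h x :> D)"

text \<open>\<open>bregman f g x y\<close> is $D_f^{g}(x,y)$, meant for \<open>g \<in> subdifferential f x\<close>.\<close>

definition bregman :: "('a::real_inner \<Rightarrow> real) \<Rightarrow> 'a \<Rightarrow> 'a \<Rightarrow> 'a \<Rightarrow> real" where
  "bregman f g x y = f y - f x - g \<bullet> (y - x)"

definition frobenius_norm :: "real^'n^'m \<Rightarrow> real" where
  "frobenius_norm A = sqrt (\<Sum>i\<in>UNIV. \<Sum>j\<in>UNIV. (A $ i $ j)\<^sup>2)"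

definition dual_fun :: "(real^'n \<Rightarrow> real) \<Rightarrow> real^'n^'m \<Rightarrow> real^'m \<Rightarrow> real^'m \<Rightarrow> real" where
  "dual_fun f A b y = conjugate f (transpose A *v y) - b \<bullet> y"

definition dual_solutions :: "(real^'n \<Rightarrow> real) \<Rightarrow> real^'n^'m \<Rightarrow> real^'m \<Rightarrow> (real^'m) set" where
  "dual_solutions f A b = {y. \<forall>z. dual_fun f A b y \<le> dual_fun f A b z}"

text \<open>On the reals, \<open>GREATEST\<close> and \<open>LEAST\<close> denote the (attained) maximum and minimum.\<close>

definition R0 :: "(real^'n \<Rightarrow> real) \<Rightarrow> real^'n^'m \<Rightarrow> real^'m \<Rightarrow> real^'m \<Rightarrow> real" where
  "R0 f A b y0 =
     (GREATEST r. \<exists>y. dual_fun f A b y \<le> dual_fun f A b y0 \<and>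
        r = (LEAST d. \<exists>yh \<in> dual_solutions f A b. d = norm (y - yh)))"

text \<open>The state after \<open>k\<close> steps is the pair $(x_k^*, t_k)$; \<open>idx\<close> is the sequence of
  chosen row indices.\<close>

primrec arbk_state ::
  "(real^'n \<Rightarrow> real) \<Rightarrow> real^'n^'m \<Rightarrow> real^'m \<Rightarrow> (nat \<Rightarrow> real) \<Rightarrow> real^'n \<Rightarrow> (nat \<Rightarrow> 'm)
    \<Rightarrow> nat \<Rightarrow> (real^'n) \<times> (real^'n)" where
  "arbk_state f A b \<theta> x0 idx 0 = (x0, x0)"
| "arbk_state f A b \<theta> x0 idx (Suc k) =
     (let (xs, t) = arbk_state f A b \<theta> x0 idx k;
          m = real CARD('m);
          i = idx k;
          a = row i A;
          c = (1 - \<theta> k) *\<^sub>R xs + \<theta> k *\<^sub>R t;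
          t' = t - (1 / (m * \<theta> k * (norm a)\<^sup>2) * (a \<bullet> gradient (conjugate f) c - b $ i)) *\<^sub>R a
      in (c + (m * \<theta> k) *\<^sub>R (t' - t), t'))"

definition arbk_dual ::
  "(real^'n \<Rightarrow> real) \<Rightarrow> real^'n^'m \<Rightarrow> real^'m \<Rightarrow> (nat \<Rightarrow> real) \<Rightarrow> real^'n \<Rightarrow> (nat \<Rightarrow> 'm)
    \<Rightarrow> nat \<Rightarrow> real^'n" where
  "arbk_dual f A b \<theta> x0 idx k = fst (arbk_state f A b \<theta> x0 idx k)"

definition arbk_primal ::
  "(real^'n \<Rightarrow> real) \<Rightarrow> real^'n^'m \<Rightarrow> real^'m \<Rightarrow> (nat \<Rightarrow> real) \<Rightarrow> real^'n \<Rightarrow> (nat \<Rightarrow> 'm)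
    \<Rightarrow> nat \<Rightarrow> real^'n" where
  "arbk_primal f A b \<theta> x0 idx k = gradient (conjugate f) (arbk_dual f A b \<theta> x0 idx k)"

text \<open>Random row indices: mutually independent, row \<open>i\<close> having probability
  proportional to its squared norm.\<close>

definition row_sampling :: "'w measure \<Rightarrow> real^'n^'m \<Rightarrow> (nat \<Rightarrow> 'w \<Rightarrow> 'm) \<Rightarrow> bool" where
  "row_sampling M A idx \<longleftrightarrow> prob_space M \<and>
     prob_space.indep_vars M (\<lambda>_. count_space UNIV) idx UNIV \<and>
     (\<forall>k i. measure M {\<omega> \<in> space M. idx k \<omega> = i} = (norm (row i A))\<^sup>2 / (frobenius_norm A)\<^sup>2)"

end

(* For theta = 1/m the three dual sequences c_k, x_k^*, t_k coincide, so the method is plain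
   randomized Bregman-Kaczmarz, i.e. coordinate descent on the dual. With delta_k the Bregman
   distance, which equals Psi(y_k) - Psi^*, the 1-smoothness of f^* gives
   E delta_{k+1} <= E delta_k - E |A x_k - b|^2 / (2 |A|_F^2), and convexity together with the
   monotone decrease of Psi gives delta_k <= R_0 |A x_k - b|. With C = 2 |A|_F^2 R_0^2 this is the
   recursion C E delta_{k+1} <= C E delta_k - (E delta_k)^2, started at delta_0 <= C/4. *)

theory Submission
  imports Defs
begin

text \<open>The identity behind delta_k is Fenchel equality: at \<open>x = G g\<close> the Bregman
  distance to \<open>xhat\<close> becomes f*(g) - <g, xhat> + f(xhat), a function of
  \<open>g\<close> alone, and for \<open>g = y v* A\<close> this is Psi(y) + f(xhat). That Psi^* =
  -f(xhat) is proved by showing that \<open>G\<close> maps every dual minimizer to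
  \<open>xhat\<close>. The obstacle is that \<open>R0\<close> is built from \<open>GREATEST\<close>
  and \<open>LEAST\<close>, which say something only if both extrema are attained, while the
  transpose of \<open>A\<close> may have a kernel and then the sublevel sets of Psi are unbounded.
  Coercivity of f* bounds \<open>y v* A\<close> on a sublevel set, and each \<open>y\<close> is
  replaced by the representative with the same image that lies in the range of \<open>A\<close>. Row
  probabilities proportional to squared row norms cancel the row norms in the coordinate decrease,
  so the average sees the whole residual. The 4 in the rate comes from the start value: smoothness
  at a dual solution, where the gradient vanishes, gives C/4. The recursion stays multiplied by C
  because \<open>R0\<close> may be 0.\<close>

section \<open>Subgradients of convex and strongly convex functions\<close>

lemma convex_on_UNIV_continuous:
  fixes f :: "'a::euclidean_space \<Rightarrow> real"
  assumes "convex_on UNIV f"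
  shows "continuous_on S f"
  using convex_on_continuous[OF open_UNIV assms] continuous_on_subset by blast

lemma convex_bounded_on_cball:
  fixes f :: "'a::euclidean_space \<Rightarrow> real"
  assumes "convex_on UNIV f"
  obtains B where "\<And>y. y \<in> cball x r \<Longrightarrow> \<bar>f y\<bar> \<le> B"
proof -
  have "compact (f ` cball x r)"
    by (intro compact_continuous_image convex_on_UNIV_continuous assms compact_cball)
  hence "bounded (f ` cball x r)" by (rule compact_imp_bounded)
  then obtain B where "\<forall>z \<in> f ` cball x r. norm z \<le> B" unfolding bounded_iff by blast
  thus ?thesis by (intro that[of B]) auto
qed

text \<open>One point suffices later. Adding \<open>K\<close> times the squared norm with
  \<open>K\<close> larger than the oscillation of \<open>f\<close> on the unit ball forces a
  minimizer \<open>z\<close> into the interior; first-order optimality there makes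
  \<open>- 2 * K\<close> times \<open>z\<close> a subgradient.\<close>

lemma convex_has_subgradient:
  fixes f :: "'a::euclidean_space \<Rightarrow> real"
  assumes conv: "convex_on UNIV f"
  shows "\<exists>x g. g \<in> subdifferential f x"
proof -
  obtain B where B: "\<And>y. y \<in> cball 0 1 \<Longrightarrow> \<bar>f y\<bar> \<le> B"
    using convex_bounded_on_cball[OF conv] by blast
  have "B \<ge> 0" using B[of 0] by auto
  define K where "K = 2 * B + 1"
  have K: "K > 0" using \<open>B \<ge> 0\<close> by (simp add: K_def)
  define h where "h y = f y + K * (norm y)\<^sup>2" for y
  have "continuous_on (cball 0 1) h" unfolding h_def
    by (intro continuous_intros convex_on_UNIV_continuous conv)
  then obtain z where z: "z \<in> cball 0 1" "\<And>y. y \<in> cball 0 1 \<Longrightarrow> h z \<le> h y"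
    using continuous_attains_inf[OF compact_cball, of 0 1 h] by (metis cball_eq_empty not_one_less_zero)
  have z1: "norm z < 1"
  proof (rule ccontr)
    assume "\<not> norm z < 1"
    hence "norm z = 1" using z(1) by simp
    hence "h z = f z + K" by (simp add: h_def)
    moreover have "h z \<le> f 0" using z(2)[of 0] by (simp add: h_def)
    ultimately show False using B[of z] B[of 0] z(1) by (simp add: K_def)
  qed
  have "f y \<ge> f z + (- 2 * K) *\<^sub>R z \<bullet> (y - z)" for y
  proof (rule ccontr)
    define v where "v = y - z"
    define q where "q = f y - f z + 2 * K * (z \<bullet> v)"
    define e where "e = K * (norm v)\<^sup>2"
    assume "\<not> ?thesis"
    hence q: "q < 0" by (simp add: q_def v_def)
    have e: "e \<ge> 0" using K by (simp add: e_def)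
    \<comment> \<open>The three bounds allow convexity along the segment, keep the trial point in
      the ball, and make the quadratic term \<open>s * e\<close> too small to compensate the
      negative slope \<open>q\<close>.\<close>
    define s where "s = min (min 1 ((1 - norm z) / (norm v + 1))) (- q / (2 * (e + 1)))"
    have "norm v + 1 > 0" by (intro add_nonneg_pos) auto
    hence "(1 - norm z) / (norm v + 1) > 0" using z1 by simp
    moreover have "- q / (2 * (e + 1)) > 0" using q e by (intro divide_pos_pos) auto
    ultimately have s: "s > 0" "s \<le> 1" unfolding s_def by linarith+
    have "s * norm v \<le> s * (norm v + 1)" using s by simp
    also have "\<dots> \<le> (1 - norm z) / (norm v + 1) * (norm v + 1)"
      by (intro mult_right_mono) (auto simp: s_def)
    also have "\<dots> = 1 - norm z" using norm_ge_zero[of v] by (simp add: add_nonneg_eq_0_iff)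
    finally have "norm (z + s *\<^sub>R v) \<le> 1"
      using norm_triangle_ineq[of z "s *\<^sub>R v"] s by simp
    hence "h z \<le> h (z + s *\<^sub>R v)" using z(2) by simp
    moreover have "f (z + s *\<^sub>R v) \<le> (1 - s) * f z + s * f y"
    proof -
      have "z + s *\<^sub>R v = (1 - s) *\<^sub>R z + s *\<^sub>R y" by (simp add: v_def algebra_simps)
      thus ?thesis using convex_onD[OF conv, of s z y] s by simp
    qed
    moreover have "(norm (z + s *\<^sub>R v))\<^sup>2 = (norm z)\<^sup>2 + 2 * s * (z \<bullet> v) + s * s * (norm v)\<^sup>2"
      unfolding power2_norm_eq_inner by (simp add: algebra_simps inner_commute)
    ultimately have "0 \<le> s * (f y - f z) + K * (2 * s * (z \<bullet> v) + s * s * (norm v)\<^sup>2)"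
      unfolding h_def by (simp add: algebra_simps)
    also have "\<dots> = s * (q + s * e)" unfolding q_def e_def by (simp add: algebra_simps power2_eq_square)
    finally have "0 \<le> s * (q + s * e)" .
    hence "0 \<le> q + s * e" using s by (simp add: zero_le_mult_iff)
    moreover have "s * (e + 1) \<le> - q / 2"
    proof -
      have "s * (e + 1) \<le> - q / (2 * (e + 1)) * (e + 1)"
        using e by (intro mult_right_mono) (auto simp: s_def)
      moreover have "- q / (2 * E) * E = - q / 2" if "E \<noteq> 0" for E
        using that by simp
      ultimately show ?thesis using e by (metis add_nonneg_pos less_irrefl zero_less_one)
    qed
    ultimately show False using q s by (simp add: algebra_simps)
  qed
  thus ?thesis unfolding subdifferential_def by blast
qed

lemma strongly_convex1D:
  assumes "strongly_convex1 f" "g \<in> subdifferential f x"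
  shows "f y \<ge> f x + g \<bullet> (y - x) + 1/2 * (norm (y - x))\<^sup>2"
  using assms unfolding strongly_convex1_def by blast

text \<open>A subgradient \<open>g0\<close> at one point \<open>z\<close> gives quadratic growth,
  which beats the tilt by \<open>g - g0\<close> outside the ball of radius
  \<open>2 * norm (g - g0)\<close>. So \<open>f\<close> minus the linear function of
  \<open>g\<close> attains its minimum, and the supremum in \<open>conjugate f g\<close> is attained
  for every \<open>g\<close>.\<close>

lemma strongly_convex1_subdifferential_surj:
  fixes f :: "'a::euclidean_space \<Rightarrow> real"
  assumes f: "strongly_convex1 f"
  shows "\<exists>x. g \<in> subdifferential f x"
proof -
  have conv: "convex_on UNIV f" using f by (simp add: strongly_convex1_def)
  obtain z g0 where g0: "g0 \<in> subdifferential f z"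
    using convex_has_subgradient[OF conv] by blast
  define r where "r = 2 * norm (g - g0)"
  have "continuous_on (cball z r) (\<lambda>y. f y - g \<bullet> y)"
    by (intro continuous_intros convex_on_UNIV_continuous conv)
  moreover have zr: "z \<in> cball z r" by (simp add: r_def)
  ultimately have "\<exists>x\<in>cball z r. \<forall>y\<in>cball z r. f x - g \<bullet> x \<le> f y - g \<bullet> y"
    by (intro continuous_attains_inf) auto
  then obtain x where x: "x \<in> cball z r"
      "\<And>y. y \<in> cball z r \<Longrightarrow> f x - g \<bullet> x \<le> f y - g \<bullet> y"
    by blast
  have "f x - g \<bullet> x \<le> f y - g \<bullet> y" for y
  proof (cases "y \<in> cball z r")
    case False
    define d where "d = y - z"
    have d: "norm d > r" using False by (simp add: d_def dist_norm norm_minus_commute)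
    have "(g - g0) \<bullet> d \<le> norm (g - g0) * norm d" by (rule norm_cauchy_schwarz)
    also have "\<dots> \<le> (norm d / 2) * norm d"
      using d by (intro mult_right_mono) (auto simp: r_def)
    finally have "(g - g0) \<bullet> d \<le> 1/2 * (norm d)\<^sup>2" by (simp add: power2_eq_square)
    moreover have "f y \<ge> f z + g0 \<bullet> d + 1/2 * (norm d)\<^sup>2"
      using strongly_convex1D[OF f g0, of y] by (simp add: d_def)
    ultimately have "f z - g \<bullet> z \<le> f y - g \<bullet> y" by (simp add: d_def algebra_simps)
    thus ?thesis using x(2)[OF zr] by linarith
  qed (use x in auto)
  hence "g \<in> subdifferential f x" by (simp add: subdifferential_def algebra_simps)
  thus ?thesis ..
qed

section \<open>The Fenchel conjugate: smoothness and coercivity\<close>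

lemma conjugate_eq:
  assumes "g \<in> subdifferential f x"
  shows "conjugate f g = g \<bullet> x - f x"
  unfolding conjugate_def
proof (rule cSup_eq_maximum)
  show "g \<bullet> x - f x \<in> range (\<lambda>y. g \<bullet> y - f y)" by blast
next
  fix r assume "r \<in> range (\<lambda>y. g \<bullet> y - f y)"
  then obtain y where "r = g \<bullet> y - f y" by blast
  thus "r \<le> g \<bullet> x - f x" using assms by (auto simp: subdifferential_def algebra_simps dest: spec[of _ y])
qed

lemma conjugate_ge:
  fixes f :: "'a::euclidean_space \<Rightarrow> real"
  assumes f: "strongly_convex1 f"
  shows "conjugate f g \<ge> g \<bullet> y - f y"
proof -
  obtain x where x: "g \<in> subdifferential f x"
    using strongly_convex1_subdifferential_surj[OF f] by blast
  hence "f y \<ge> f x + g \<bullet> (y - x)" by (simp add: subdifferential_def)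
  thus ?thesis unfolding conjugate_eq[OF x] by (simp add: algebra_simps)
qed

lemma conjugate_upper:
  fixes f :: "'a::euclidean_space \<Rightarrow> real"
  assumes f: "strongly_convex1 f" and x: "g \<in> subdifferential f x"
  shows "conjugate f h \<le> conjugate f g + (h - g) \<bullet> x + 1/2 * (norm (h - g))\<^sup>2"
proof -
  obtain y where y: "h \<in> subdifferential f y"
    using strongly_convex1_subdifferential_surj[OF f] by blast
  \<comment> \<open>Young's inequality: the quadratic term from strong convexity absorbs the unknown
    displacement \<open>y - x\<close>, leaving only \<open>h - g\<close>.\<close>
  have "0 \<le> (norm ((h - g) - (y - x)))\<^sup>2" by simp
  hence "2 * ((h - g) \<bullet> (y - x)) \<le> (norm (h - g))\<^sup>2 + (norm (y - x))\<^sup>2"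
    unfolding power2_norm_eq_inner by (simp add: algebra_simps inner_commute)
  moreover have "f y \<ge> f x + g \<bullet> (y - x) + 1/2 * (norm (y - x))\<^sup>2"
    by (rule strongly_convex1D[OF f x])
  ultimately show ?thesis
    unfolding conjugate_eq[OF x] conjugate_eq[OF y] by (simp add: algebra_simps)
qed

text \<open>\<open>conjugate_ge\<close> and \<open>conjugate_upper\<close> squeeze the remainder of
  the affine model between 0 and half the squared norm of the increment.\<close>

lemma conjugate_GDERIV:
  fixes f :: "'a::euclidean_space \<Rightarrow> real"
  assumes f: "strongly_convex1 f" and x: "g \<in> subdifferential f x"
  shows "GDERIV (conjugate f) g :> x"
  unfolding gderiv_def has_derivative_at
proof (intro conjI)
  show "bounded_linear (\<lambda>h. h \<bullet> x)" by (rule bounded_linear_inner_left)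
  have bd: "norm (norm (conjugate f (g + h) - conjugate f g - h \<bullet> x) / norm h) \<le> norm h" for h
  proof -
    have "conjugate f (g + h) \<ge> (g + h) \<bullet> x - f x" by (rule conjugate_ge[OF f])
    hence "0 \<le> conjugate f (g + h) - conjugate f g - h \<bullet> x"
      unfolding conjugate_eq[OF x] by (simp add: algebra_simps)
    moreover have "conjugate f (g + h) - conjugate f g - h \<bullet> x \<le> 1/2 * (norm h)\<^sup>2"
      using conjugate_upper[OF f x, of "g + h"] by simp
    moreover have "1/2 * (norm h)\<^sup>2 \<le> norm h * norm h" by (simp add: power2_eq_square)
    ultimately have "norm (conjugate f (g + h) - conjugate f g - h \<bullet> x) \<le> norm h * norm h"
      by simp
    thus ?thesis by (cases "h = 0") (simp_all add: divide_simps)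
  qed
  show "(\<lambda>h. norm (conjugate f (g + h) - conjugate f g - h \<bullet> x) / norm h) \<midarrow>0\<rightarrow> 0"
    by (rule Lim_null_comparison[OF always_eventually[OF allI[OF bd]]])
       (auto intro!: tendsto_eq_intros)
qed

lemma gradient_eqI:
  assumes "GDERIV h x :> D"
  shows "gradient h x = D"
  unfolding gradient_def
proof (rule the_equality, rule assms)
  fix D' assume "GDERIV h x :> D'"
  hence "(\<lambda>h. h \<bullet> D') = (\<lambda>h. h \<bullet> D)"
    using assms unfolding gderiv_def by (rule has_derivative_unique)
  hence "(D' - D) \<bullet> D' = (D' - D) \<bullet> D" by meson
  hence "(D' - D) \<bullet> (D' - D) = 0" by (simp add: inner_diff_right)
  thus "D' = D" by simp
qed

lemma gradient_conjugate_subdifferential: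
  fixes f :: "'a::euclidean_space \<Rightarrow> real"
  assumes f: "strongly_convex1 f"
  shows "g \<in> subdifferential f (gradient (conjugate f) g)"
  using strongly_convex1_subdifferential_surj[OF f, of g]
    gradient_eqI[OF conjugate_GDERIV[OF f]] by auto

lemma conjugate_continuous:
  fixes f :: "'a::euclidean_space \<Rightarrow> real"
  assumes f: "strongly_convex1 f"
  shows "continuous_on S (conjugate f)"
proof -
  have "isCont (conjugate f) g" for g
    using conjugate_GDERIV[OF f gradient_conjugate_subdifferential[OF f, of g]]
    unfolding gderiv_def by (rule has_derivative_continuous)
  thus ?thesis by (simp add: continuous_at_imp_continuous_on)
qed

text \<open>Testing the supremum at distance at most 1 from \<open>x\<close> in the direction of
  \<open>g\<close> gains \<open>norm g\<close>, while \<open>f\<close> is bounded on that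
  ball.\<close>

lemma conjugate_coercive:
  fixes f :: "'a::euclidean_space \<Rightarrow> real"
  assumes f: "strongly_convex1 f"
  shows "\<exists>B. \<forall>g. norm g \<le> conjugate f g - g \<bullet> x + B"
proof -
  have "convex_on UNIV f" using f by (simp add: strongly_convex1_def)
  then obtain B where B: "\<And>y. y \<in> cball x 1 \<Longrightarrow> \<bar>f y\<bar> \<le> B"
    using convex_bounded_on_cball by blast
  have "norm g \<le> conjugate f g - g \<bullet> x + B" for g
  proof -
    define y where "y = x + sgn g"
    have "y \<in> cball x 1" by (simp add: y_def dist_norm norm_sgn)
    hence "f y \<le> B" using B by force
    moreover have "g \<bullet> y = g \<bullet> x + norm g"
      
      by (cases "g = 0") (simp_all add: y_def inner_add_right sgn_div_norm dot_square_norm power2_eq_square)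
    ultimately show ?thesis using conjugate_ge[OF f, of g y] by linarith
  qed
  thus ?thesis by blast
qed

section \<open>Linear algebra of the transpose\<close>

text \<open>The orthogonal projection of \<open>y\<close> onto the range of \<open>A\<close> drops
  exactly a kernel part of the transpose, and on that range the transpose is injective, hence
  bounded below.\<close>

lemma vector_matrix_range_representative:
  fixes A :: "real^'n^'m"
  shows "\<exists>c>0. \<forall>y. \<exists>w. w v* A = y v* A \<and> c * norm w \<le> norm (y v* A)"
proof -
  define S where "S = range ((*v) A)"
  have S: "subspace S" unfolding S_def
    by (intro linear_subspace_image matrix_vector_mul_linear subspace_UNIV)
  have "bounded_linear (\<lambda>w. w v* A)"
    using matrix_vector_mul_bounded_linear[of "transpose A"] unfolding transpose_matrix_vector .
  moreover have "w = 0" if w: "w \<in> S" "w v* A = 0" for w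
  proof -
    obtain u where "w = A *v u" using w(1) by (auto simp: S_def)
    hence "w \<bullet> w = 0" using w(2) dot_lmul_matrix[of w A u] by simp
    thus ?thesis by simp
  qed
  ultimately obtain c where c: "c > 0" "\<And>w. w \<in> S \<Longrightarrow> norm (w v* A) \<ge> c * norm w"
    using injective_imp_isometric[OF closed_subspace[OF S] S] by blast
  have "\<exists>w. w v* A = y v* A \<and> c * norm w \<le> norm (y v* A)" for y
  proof -
    obtain w z where wz: "w \<in> span S" "\<And>v. v \<in> span S \<Longrightarrow> orthogonal z v" "y = w + z"
      using orthogonal_subspace_decomp_exists[of S y] by blast
    have "A *v (z v* A) \<in> span S" by (intro span_base) (simp add: S_def)
    hence "(z v* A) \<bullet> (z v* A) = 0" using wz(2) by (simp add: dot_lmul_matrix orthogonal_def)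
    hence "z v* A = 0" by simp
    hence "w v* A = y v* A" using wz(3)
      by (metis add.right_neutral matrix_vector_right_distrib transpose_matrix_vector)
    moreover have "w \<in> S" using wz(1) span_minimal[OF order_refl S] by blast
    ultimately show ?thesis using c(2)[of w] by (intro exI[of _ w]) simp
  qed
  with c(1) show ?thesis by blast
qed

lemma norm_sq_eq_sum_components:
  fixes x :: "real^'k"
  shows "(norm x)\<^sup>2 = (\<Sum>i\<in>UNIV. (x $ i)\<^sup>2)"
  unfolding power2_norm_eq_inner by (simp add: inner_vec_def power2_eq_square)

lemma frobenius_norm_sq_eq_sum_rows: "(frobenius_norm A)\<^sup>2 = (\<Sum>i\<in>UNIV. (norm (row i A))\<^sup>2)"
proof -
  have "(frobenius_norm A)\<^sup>2 = (\<Sum>i\<in>UNIV. \<Sum>j\<in>UNIV. (A $ i $ j)\<^sup>2)"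
    unfolding frobenius_norm_def by (simp add: sum_nonneg)
  thus ?thesis by (simp add: norm_sq_eq_sum_components row_def)
qed

lemma norm_vector_matrix_le_frobenius:
  fixes A :: "real^'n^'m"
  shows "(norm (y v* A))\<^sup>2 \<le> (frobenius_norm A)\<^sup>2 * (norm y)\<^sup>2"
proof -
  have "(norm (y v* A))\<^sup>2 = (\<Sum>j\<in>UNIV. (\<Sum>i\<in>UNIV. A $ i $ j * y $ i)\<^sup>2)"
    by (simp add: norm_sq_eq_sum_components vector_matrix_mult_def mult.commute)
  also have "\<dots> \<le> (\<Sum>j\<in>UNIV. (\<Sum>i\<in>UNIV. (A $ i $ j)\<^sup>2) * (\<Sum>i\<in>UNIV. (y $ i)\<^sup>2))"
    by (intro sum_mono Cauchy_Schwarz_ineq_sum)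
  also have "\<dots> = (\<Sum>j\<in>UNIV. \<Sum>i\<in>UNIV. (A $ i $ j)\<^sup>2) * (norm y)\<^sup>2"
    by (simp add: norm_sq_eq_sum_components sum_distrib_right)
  also have "(\<Sum>j\<in>UNIV. \<Sum>i\<in>UNIV. (A $ i $ j)\<^sup>2) = (\<Sum>i\<in>UNIV. \<Sum>j\<in>UNIV. (A $ i $ j)\<^sup>2)"
    by (rule sum.swap)
  also have "\<dots> = (frobenius_norm A)\<^sup>2"
    unfolding frobenius_norm_def by (simp add: sum_nonneg)
  finally show ?thesis .
qed

section \<open>The dual problem, strong duality and the radius \<open>R0\<close>\<close>

locale constrained_minimum =
  fixes f :: "real^'n \<Rightarrow> real" and A :: "real^'n^'m" and b :: "real^'m" and xhat :: "real^'n"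
  assumes f: "strongly_convex1 f"
    and feasible: "A *v xhat = b"
    and optimal: "\<And>x. A *v x = b \<Longrightarrow> f xhat \<le> f x"
begin

abbreviation G :: "real^'n \<Rightarrow> real^'n" where "G \<equiv> gradient (conjugate f)"

text \<open>As a function of \<open>g\<close> this is convex and 1-smooth with gradient
  \<open>G g - xhat\<close>, which \<open>gap_lower\<close> and \<open>gap_upper\<close>
  express.\<close>

definition gap :: "real^'n \<Rightarrow> real" where "gap g = bregman f g (G g) xhat"

lemmas G_subdifferential = gradient_conjugate_subdifferential[OF f]

lemma gap_eq: "gap g = conjugate f g - g \<bullet> xhat + f xhat"
  unfolding gap_def bregman_def conjugate_eq[OF G_subdifferential[of g]]
  by (simp add: inner_diff_right)

lemma gap_ge: "1/2 * (norm (G g - xhat))\<^sup>2 \<le> gap g"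
  using strongly_convex1D[OF f G_subdifferential[of g], of xhat]
  by (simp add: gap_def bregman_def norm_minus_commute)

lemma gap_nonneg: "0 \<le> gap g"
  using gap_ge[of g] zero_le_power2[of "norm (G g - xhat)"] by linarith

lemma gap_upper: "gap (g + d) \<le> gap g + d \<bullet> (G g - xhat) + 1/2 * (norm d)\<^sup>2"
  using conjugate_upper[OF f G_subdifferential[of g], of "g + d"]
  by (simp add: gap_eq inner_add_left inner_diff_right)

lemma gap_lower: "gap h \<ge> gap g + (h - g) \<bullet> (G g - xhat)"
  using conjugate_ge[OF f, of h "G g"] unfolding gap_eq conjugate_eq[OF G_subdifferential[of g]]
  by (simp add: inner_diff_left inner_diff_right)

lemma continuous_on_gap: "continuous_on S gap"
  unfolding gap_eq[abs_def] by (intro continuous_intros conjugate_continuous f)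

lemma continuous_on_gap_vector_matrix: "continuous_on S (\<lambda>y. gap (y v* A))"
proof -
  have "continuous_on S ((*v) (transpose A))" by (intro linear_continuous_on matrix_vector_mul_bounded_linear)
  hence "continuous_on S (\<lambda>y. y v* A)" by simp
  thus ?thesis by (rule continuous_on_compose2[OF continuous_on_gap[of UNIV]]) auto
qed

lemma dual_fun_eq: "dual_fun f A b y = gap (y v* A) - f xhat"
  by (simp add: dual_fun_def gap_eq dot_lmul_matrix feasible inner_commute[of b y])

lemma gap_sublevel_representative:
  "\<exists>r. \<forall>y. gap (y v* A) \<le> l \<longrightarrow> (\<exists>w\<in>cball 0 r. w v* A = y v* A)"
proof -
  obtain B where B: "\<And>g. norm g \<le> conjugate f g - g \<bullet> xhat + B"
    using conjugate_coercive[OF f] by blast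
  obtain c where c: "c > 0" "\<And>y. \<exists>w. w v* A = y v* A \<and> c * norm w \<le> norm (y v* A)"
    using vector_matrix_range_representative by blast
  have "\<exists>w\<in>cball 0 ((l - f xhat + B) / c). w v* A = y v* A" if y: "gap (y v* A) \<le> l" for y
  proof -
    obtain w where w: "w v* A = y v* A" "c * norm w \<le> norm (y v* A)" using c(2) by blast
    have "c * norm w \<le> l - f xhat + B" using w(2) B[of "y v* A"] y by (simp add: gap_eq)
    hence "w \<in> cball 0 ((l - f xhat + B) / c)" using c(1) by (simp add: field_simps)
    with w(1) show ?thesis by blast
  qed
  thus ?thesis by blast
qed

lemma dual_solutions_nonempty: "dual_solutions f A b \<noteq> {}"
proof -
  obtain r where r: "\<And>y. gap (y v* A) \<le> gap 0 \<Longrightarrow> \<exists>w\<in>cball 0 r. w v* A = y v* A"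
    using gap_sublevel_representative[of "gap 0"] by blast
  have "cball (0::real^'m) r \<noteq> {}" using r[of 0] by fastforce
  hence "\<exists>w\<in>cball 0 r. \<forall>y\<in>cball 0 r. gap (w v* A) \<le> gap (y v* A)"
    by (intro continuous_attains_inf continuous_on_gap_vector_matrix compact_cball)
  then obtain w where w: "\<And>y. y \<in> cball 0 r \<Longrightarrow> gap (w v* A) \<le> gap (y v* A)" by blast
  have le: "gap (w v* A) \<le> gap (y v* A)" if "gap (y v* A) \<le> gap 0" for y
    using r[OF that] w by metis
  \<comment> \<open>A \<open>y\<close> outside the sublevel set has a value above
    \<open>gap 0\<close>, and \<open>gap 0\<close> is itself covered by \<open>le\<close>.\<close>
  have "gap (w v* A) \<le> gap (y v* A)" for y
    using le[of y] le[of 0] by fastforce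
  hence "w \<in> dual_solutions f A b" by (simp add: dual_solutions_def dual_fun_eq)
  thus ?thesis by blast
qed

text \<open>A gradient step cannot improve a dual minimizer, so its residual \<open>r\<close>
  vanishes and \<open>G g\<close> is feasible. As \<open>g\<close> is an image under the transpose,
  it is orthogonal to \<open>xhat - G g\<close>, and strong convexity against optimality of
  \<open>xhat\<close> leaves no distance between the two.\<close>

lemma dual_solution_gradient:
  assumes "y \<in> dual_solutions f A b"
  shows "G (y v* A) = xhat"
proof -
  define g where "g = y v* A"
  define r where "r = A *v G g - b"
  define S where "S = (frobenius_norm A)\<^sup>2"
  \<comment> \<open>\<open>S\<close> bounds the smoothness constant of the dual function, and any
    step below \<open>2 / S\<close> decreases it; the added 1 also covers
    \<open>S = 0\<close>.\<close>
  define s where "s = 1 / (S + 1)"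
  have S: "S \<ge> 0" by (simp add: S_def)
  have "(y - s *\<^sub>R r) v* A = g + (- s) *\<^sub>R (r v* A)"
    unfolding transpose_matrix_vector[symmetric] g_def
    by (simp add: matrix_vector_mult_diff_distrib matrix_vector_mult_scaleR)
  hence "gap g \<le> gap (g + (- s) *\<^sub>R (r v* A))"
    using assms by (simp add: dual_solutions_def dual_fun_eq g_def) metis
  also have "\<dots> \<le> gap g - s * (norm r)\<^sup>2 + 1/2 * (s\<^sup>2 * (norm (r v* A))\<^sup>2)"
    using gap_upper[of g "(- s) *\<^sub>R (r v* A)"]
    by (simp add: dot_lmul_matrix matrix_vector_mult_diff_distrib feasible power_mult_distrib
        power2_norm_eq_inner flip: r_def)
  also have "\<dots> \<le> gap g - s * (norm r)\<^sup>2 + 1/2 * (s\<^sup>2 * (S * (norm r)\<^sup>2))"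
    using norm_vector_matrix_le_frobenius[of r A] unfolding S_def
    by (intro add_left_mono mult_left_mono) auto
  finally have "0 \<le> s * (norm r)\<^sup>2 * (s * S / 2 - 1)"
    by (simp add: algebra_simps power2_eq_square)
  moreover have "s > 0" "s * S / 2 - 1 < 0" using S by (auto simp: s_def field_simps)
  ultimately have "(norm r)\<^sup>2 \<le> 0" by (auto simp: zero_le_mult_iff mult_le_0_iff)
  hence feas: "A *v G g = b" by (simp add: r_def)
  have "g \<bullet> (xhat - G g) = 0"
    by (simp add: g_def dot_lmul_matrix matrix_vector_mult_diff_distrib feasible feas[unfolded g_def])
  hence "f xhat \<ge> f (G g) + 1/2 * (norm (xhat - G g))\<^sup>2"
    using strongly_convex1D[OF f G_subdifferential[of g], of xhat] by simp
  hence "(norm (xhat - G g))\<^sup>2 \<le> 0" using optimal[OF feas] by linarith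
  thus ?thesis by (simp add: g_def)
qed

text \<open>Strong duality: a minimizer exists and is mapped by \<open>G\<close> to
  \<open>xhat\<close>, where the Bregman distance is 0, so the minimal value of the nonnegative
  \<open>gap\<close> is 0.\<close>

lemma dual_solutions_eq: "dual_solutions f A b = {y. gap (y v* A) = 0}"
proof -
  obtain y where y: "y \<in> dual_solutions f A b" using dual_solutions_nonempty by blast
  have "gap (y v* A) = 0"
    unfolding gap_def bregman_def dual_solution_gradient[OF y] by simp
  with y show ?thesis unfolding dual_solutions_def dual_fun_eq
    using gap_nonneg by (auto intro: antisym) (metis antisym)
qed

lemma closed_dual_solutions: "closed (dual_solutions f A b)"
  unfolding dual_solutions_eq
  by (rule closed_Collect_eq[OF continuous_on_gap_vector_matrix continuous_on_const])

lemma dual_solution_nearest: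
  obtains yh where "yh \<in> dual_solutions f A b" "infdist y (dual_solutions f A b) = norm (y - yh)"
  using infdist_attains_inf[OF closed_dual_solutions dual_solutions_nonempty, of y]
  by (auto simp: dist_norm)

text \<open>The solution set is closed and nonempty, so the minimum is attained; as
  \<open>infdist\<close> it is known to be continuous in \<open>y\<close>.\<close>

lemma Least_dual_solution_dist:
  "(LEAST d. \<exists>yh \<in> dual_solutions f A b. d = norm (y - yh)) = infdist y (dual_solutions f A b)"
proof (rule Least_equality)
  show "\<exists>yh\<in>dual_solutions f A b. infdist y (dual_solutions f A b) = norm (y - yh)"
    using dual_solution_nearest by blast
qed (auto simp flip: dist_norm intro: infdist_le)

text \<open>\<open>y - w\<close> lies in the kernel of the transpose, so shifting the solution
  nearest to \<open>w\<close> by it gives a solution equally far from \<open>y\<close>.\<close>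

lemma infdist_dual_solutions_le:
  assumes "w v* A = y v* A"
  shows "infdist y (dual_solutions f A b) \<le> infdist w (dual_solutions f A b)"
proof -
  obtain z where z: "z \<in> dual_solutions f A b" "infdist w (dual_solutions f A b) = norm (w - z)"
    by (rule dual_solution_nearest)
  have "(z + (y - w)) v* A = z v* A"
    using assms unfolding transpose_matrix_vector[symmetric]
    by (simp add: matrix_vector_right_distrib matrix_vector_mult_diff_distrib)
  hence "z + (y - w) \<in> dual_solutions f A b" using z(1) by (simp add: dual_solutions_eq)
  hence "infdist y (dual_solutions f A b) \<le> dist y (z + (y - w))" by (rule infdist_le)
  thus ?thesis by (simp add: z(2) dist_norm algebra_simps)
qed

text \<open>The sublevel set of the dual function need not be bounded, but both the dual function and
  the distance to the solution set are invariant under translation by the kernel of \<open>A\<^sup>T\<close>,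
  and modulo that kernel the sublevel set is compact. So the maximum in \<open>R0\<close> is attained.\<close>

lemma infdist_dual_solutions_le_R0:
  assumes y: "gap (y v* A) \<le> gap (y0 v* A)"
  shows "infdist y (dual_solutions f A b) \<le> R0 f A b y0"
proof -
  define D where "D y = infdist y (dual_solutions f A b)" for y
  obtain r where r: "\<And>y. gap (y v* A) \<le> gap (y0 v* A) \<Longrightarrow> \<exists>w\<in>cball 0 r. w v* A = y v* A"
    using gap_sublevel_representative[of "gap (y0 v* A)"] by blast
  define K where "K = cball 0 r \<inter> {w. gap (w v* A) \<le> gap (y0 v* A)}"
  have "compact K" unfolding K_def
    by (intro compact_Int_closed compact_cball
        closed_Collect_le[OF continuous_on_gap_vector_matrix continuous_on_const])
  moreover have "K \<noteq> {}" using r[of y0] by (auto simp: K_def)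
  moreover have "continuous_on K D" unfolding D_def[abs_def] by (intro continuous_intros)
  ultimately obtain ym where ym: "ym \<in> K" "\<And>w. w \<in> K \<Longrightarrow> D w \<le> D ym"
    using continuous_attains_sup by metis
  have max: "D y \<le> D ym" if y: "gap (y v* A) \<le> gap (y0 v* A)" for y
  proof -
    obtain w where w: "w \<in> cball 0 r" "w v* A = y v* A" using r[OF y] by blast
    hence "w \<in> K" using y by (simp add: K_def)
    with infdist_dual_solutions_le[OF w(2)] ym(2)[of w] show ?thesis by (simp add: D_def)
  qed
  have "R0 f A b y0 = D ym"
    unfolding R0_def Least_dual_solution_dist dual_fun_eq
    using ym(1) max by (intro Greatest_equality) (auto simp: K_def D_def)
  with max[OF y] show ?thesis by (simp add: D_def)
qed

lemma gap_le_residual: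
  assumes y: "gap (y v* A) \<le> gap (y0 v* A)"
  shows "gap (y v* A) \<le> R0 f A b y0 * norm (A *v G (y v* A) - b)"
proof -
  define g where "g = y v* A"
  obtain z where z: "z \<in> dual_solutions f A b" "infdist y (dual_solutions f A b) = norm (y - z)"
    by (rule dual_solution_nearest)
  \<comment> \<open>The tangent at \<open>g\<close> is compared with the value 0 at the nearest
    solution \<open>z\<close>; moving \<open>A\<close> across the inner product then produces the
    residual.\<close>
  have "gap g \<le> - ((z v* A - g) \<bullet> (G g - xhat))"
    using gap_lower[of g "z v* A"] z(1) by (simp add: dual_solutions_eq)
  also have "\<dots> = (y - z) \<bullet> (A *v G g - b)"
    by (simp add: g_def inner_diff_left inner_diff_right dot_lmul_matrix feasible)
  also have "\<dots> \<le> norm (y - z) * norm (A *v G g - b)" by (rule norm_cauchy_schwarz)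
  also have "\<dots> \<le> R0 f A b y0 * norm (A *v G g - b)"
    using infdist_dual_solutions_le_R0[OF y] z(2) by (intro mult_right_mono) auto
  finally show ?thesis by (simp add: g_def)
qed

text \<open>At a dual solution both the value and the gradient of \<open>gap\<close> vanish, so only
  the quadratic term of \<open>gap_upper\<close> remains.\<close>

lemma gap_init: "gap (y0 v* A) \<le> (frobenius_norm A)\<^sup>2 / 2 * (R0 f A b y0)\<^sup>2"
proof -
  obtain z where z: "z \<in> dual_solutions f A b" "infdist y0 (dual_solutions f A b) = norm (y0 - z)"
    by (rule dual_solution_nearest)
  have R: "norm (y0 - z) \<le> R0 f A b y0" using infdist_dual_solutions_le_R0[of y0 y0] z(2) by simp
  have *: "y0 v* A = z v* A + (y0 - z) v* A"
    unfolding transpose_matrix_vector[symmetric] by (simp add: matrix_vector_mult_diff_distrib)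
  have "gap (y0 v* A) \<le> 1/2 * (norm ((y0 - z) v* A))\<^sup>2"
    using gap_upper[of "z v* A" "(y0 - z) v* A"] z(1)
    unfolding * dual_solution_gradient[OF z(1)] by (simp add: dual_solutions_eq)
  also have "\<dots> \<le> 1/2 * ((frobenius_norm A)\<^sup>2 * (norm (y0 - z))\<^sup>2)"
    using norm_vector_matrix_le_frobenius[of "y0 - z" A] by simp
  also have "\<dots> \<le> 1/2 * ((frobenius_norm A)\<^sup>2 * (R0 f A b y0)\<^sup>2)"
    using R by (intro mult_left_mono power_mono) auto
  finally show ?thesis by simp
qed

section \<open>Decrease in one randomized Bregman-Kaczmarz step\<close>

definition rbk_step :: "'m \<Rightarrow> real^'n \<Rightarrow> real^'n" where
  "rbk_step i g = g - ((row i A \<bullet> G g - b $ i) / (norm (row i A))\<^sup>2) *\<^sub>R row i A"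

lemma row_inner: "row i A \<bullet> x = (A *v x) $ i"
  by (simp add: matrix_vector_mul_component row_def)

lemma row_eq_vector_matrix: "row i A = axis i 1 v* A"
  unfolding vec_eq_iff by (simp add: row_def vector_matrix_mult_def axis_def if_distrib if_distribR cong: if_cong)

lemma rbk_step_range: "\<exists>z. rbk_step i (y v* A) = z v* A"
proof -
  define s where "s = (row i A \<bullet> G (y v* A) - b $ i) / (norm (row i A))\<^sup>2"
  have "rbk_step i (y v* A) = (y - s *\<^sub>R axis i 1) v* A"
    unfolding rbk_step_def s_def[symmetric] unfolding row_eq_vector_matrix transpose_matrix_vector[symmetric]
    by (simp only: matrix_vector_mult_diff_distrib matrix_vector_mult_scaleR)
  thus ?thesis ..
qed

text \<open>The residual component is the partial derivative of the dual function in coordinate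
  \<open>i\<close>, and the squared row norm is a smoothness constant there; the step minimizes the
  resulting quadratic model.\<close>

lemma gap_rbk_step:
  assumes "row i A \<noteq> 0"
  shows "gap (rbk_step i g) \<le> gap g - ((A *v G g - b) $ i)\<^sup>2 / (2 * (norm (row i A))\<^sup>2)"
proof -
  define n where "n = (norm (row i A))\<^sup>2"
  define r where "r = (A *v G g - b) $ i"
  have n: "n > 0" using assms by (simp add: n_def)
  have r: "row i A \<bullet> (G g - xhat) = r"
    by (simp add: inner_diff_right row_inner r_def feasible)
  have "rbk_step i g = g + (- (r / n)) *\<^sub>R row i A"
    by (simp add: rbk_step_def r_def n_def row_inner)
  moreover have "(norm ((- (r / n)) *\<^sub>R row i A))\<^sup>2 = (r / n)\<^sup>2 * n"
    unfolding norm_scaleR power_mult_distrib n_def by (simp add: power_divide)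
  ultimately have "gap (rbk_step i g) \<le> gap g - r / n * r + 1/2 * ((r / n)\<^sup>2 * n)"
    using gap_upper[of g "(- (r / n)) *\<^sub>R row i A"] r by simp
  also have "\<dots> = gap g - r\<^sup>2 / (2 * n)"
    using n by (simp add: field_simps power2_eq_square)
  finally show ?thesis by (simp add: n_def r_def)
qed

text \<open>Decrease for every row, not only on average, keeps each random path in the initial
  sublevel set, over which \<open>R0\<close> is taken.\<close>

lemma gap_rbk_step_le:
  assumes "row i A \<noteq> 0"
  shows "gap (rbk_step i g) \<le> gap g"
proof -
  have "0 \<le> ((A *v G g - b) $ i)\<^sup>2 / (2 * (norm (row i A))\<^sup>2)" by simp
  with gap_rbk_step[OF assms, of g] show ?thesis by linarith
qed

lemma gap_rbk_step_average:
  assumes rows: "\<And>i. row i A \<noteq> 0" and y: "gap (y v* A) \<le> gap (y0 v* A)"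
  defines "C \<equiv> 2 * (frobenius_norm A)\<^sup>2 * (R0 f A b y0)\<^sup>2"
  shows "C * (\<Sum>i\<in>UNIV. (norm (row i A))\<^sup>2 / (frobenius_norm A)\<^sup>2 * gap (rbk_step i (y v* A)))
    \<le> C * gap (y v* A) - (gap (y v* A))\<^sup>2"
proof -
  define g where "g = y v* A"
  define S where "S = (frobenius_norm A)\<^sup>2"
  define \<rho> where "\<rho> = A *v G g - b"
  have S: "S > 0" unfolding S_def frobenius_norm_sq_eq_sum_rows
    using rows by (intro sum_pos) auto
  have "(\<Sum>i\<in>UNIV. (norm (row i A))\<^sup>2 / S * gap (rbk_step i g))
      \<le> (\<Sum>i\<in>UNIV. (norm (row i A))\<^sup>2 / S * (gap g - (\<rho> $ i)\<^sup>2 / (2 * (norm (row i A))\<^sup>2)))"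
    unfolding \<rho>_def using S by (intro sum_mono mult_left_mono gap_rbk_step rows) auto
  also have "\<dots> = (\<Sum>i\<in>UNIV. (norm (row i A))\<^sup>2 * (gap g / S) - (\<rho> $ i)\<^sup>2 / (2 * S))"
    using rows S by (intro sum.cong) (auto simp: field_simps)
  also have "\<dots> = S * (gap g / S) - (norm \<rho>)\<^sup>2 / (2 * S)"
    by (simp add: sum_subtractf S_def frobenius_norm_sq_eq_sum_rows norm_sq_eq_sum_components[of \<rho>]
        flip: sum_distrib_right sum_divide_distrib)
  also have "S * (gap g / S) = gap g" using S by simp
  finally have "C * (\<Sum>i\<in>UNIV. (norm (row i A))\<^sup>2 / S * gap (rbk_step i g))
      \<le> C * (gap g - (norm \<rho>)\<^sup>2 / (2 * S))"
    using S by (intro mult_left_mono) (auto simp: C_def S_def)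
  \<comment> \<open>\<open>C\<close> is chosen so that \<open>C / (2 * S)\<close> is the square of
    \<open>R0\<close>, matching the bound of \<open>gap_le_residual\<close>.\<close>
  also have "\<dots> = C * gap g - (R0 f A b y0 * norm \<rho>)\<^sup>2"
    using S by (simp add: C_def algebra_simps power_mult_distrib flip: S_def)
  also have "\<dots> \<le> C * gap g - (gap g)\<^sup>2"
    using gap_le_residual[OF y] gap_nonneg[of g]
    by (intro diff_left_mono power_mono) (auto simp: g_def \<rho>_def)
  finally show ?thesis by (simp add: g_def S_def)
qed

end


section \<open>Expectations over finite histories of row indices\<close>

lemma (in prob_space) measurable_history:
  fixes idx :: "nat \<Rightarrow> 'a \<Rightarrow> 'm::finite"
  assumes "\<And>j. random_variable (count_space UNIV) (idx j)"
  shows "(\<lambda>\<omega>. restrict (\<lambda>j. idx j \<omega>) {..<k}) \<in> measurable M (count_space (PiE {..<k} (\<lambda>_. UNIV)))"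
proof -
  have "(\<lambda>\<omega>. restrict (\<lambda>j. idx j \<omega>) {..<k}) \<in> measurable M (PiM {..<k} (\<lambda>_. count_space UNIV))"
    using assms by (intro measurable_restrict) auto
  thus ?thesis by (subst (asm) count_space_PiM_finite) auto
qed

text \<open>There are finitely many histories of length \<open>k\<close>, so any function of them is
  measurable and bounded by the sum of its absolute values.\<close>

lemma (in prob_space) integrable_history:
  fixes idx :: "nat \<Rightarrow> 'a \<Rightarrow> 'm::finite" and Q :: "(nat \<Rightarrow> 'm) \<Rightarrow> real"
  assumes idx: "\<And>j. random_variable (count_space UNIV) (idx j)"
    and Q: "\<And>u v. (\<And>j. j < k \<Longrightarrow> u j = v j) \<Longrightarrow> Q u = Q v"
  shows "integrable M (\<lambda>\<omega>. Q (\<lambda>j. idx j \<omega>))"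
proof -
  define P where "P = PiE {..<k} (\<lambda>_. UNIV :: 'm set)"
  have eq: "Q (\<lambda>j. idx j \<omega>) = Q (restrict (\<lambda>j. idx j \<omega>) {..<k})" for \<omega>
    by (rule Q) simp
  have "Q \<in> borel_measurable (count_space P)" by simp
  from measurable_compose[OF measurable_history[OF idx] this[unfolded P_def]]
  have "(\<lambda>\<omega>. Q (\<lambda>j. idx j \<omega>)) \<in> borel_measurable M" unfolding eq .
  moreover have "finite P" unfolding P_def by (intro finite_PiE) auto
  hence "norm (Q u) \<le> (\<Sum>u\<in>P. norm (Q u))" if "u \<in> P" for u
    using that by (intro member_le_sum) auto
  hence "norm (Q (\<lambda>j. idx j \<omega>)) \<le> (\<Sum>u\<in>P. norm (Q u))" for \<omega>
    unfolding eq by (simp add: P_def)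
  ultimately show ?thesis by (intro integrable_const_bound) auto
qed

text \<open>This takes the place of conditioning on the past: split by the value of
  \<open>idx k\<close>, whose indicator is independent of anything determined by the indices below
  \<open>k\<close>.\<close>

lemma (in prob_space) expectation_history_step:
  fixes idx :: "nat \<Rightarrow> 'a \<Rightarrow> 'm::finite" and F :: "(nat \<Rightarrow> 'm) \<Rightarrow> 'm \<Rightarrow> real"
  assumes indep: "indep_vars (\<lambda>_. count_space UNIV) idx UNIV"
    and F: "\<And>u v i. (\<And>j. j < k \<Longrightarrow> u j = v j) \<Longrightarrow> F u i = F v i"
  shows "expectation (\<lambda>\<omega>. F (\<lambda>j. idx j \<omega>) (idx k \<omega>))
    = (\<Sum>i\<in>UNIV. prob {\<omega> \<in> space M. idx k \<omega> = i} * expectation (\<lambda>\<omega>. F (\<lambda>j. idx j \<omega>) i))"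
proof -
  have idx: "random_variable (count_space UNIV) (idx j)" for j
    using indep unfolding indep_vars_def by blast
  define X where "X i \<omega> = (if idx k \<omega> = i then 1 else 0 :: real)" for i \<omega>
  define Y where "Y i \<omega> = F (\<lambda>j. idx j \<omega>) i" for i \<omega>
  have intY: "integrable M (Y i)" for i
    unfolding Y_def by (rule integrable_history[OF idx, of k]) (rule F)
  have ev: "{\<omega> \<in> space M. idx k \<omega> = i} \<in> events" for i
    using measurable_sets[OF idx[of k], of "{i}"] by (simp add: vimage_def Int_def conj_commute)
  have X: "X i \<omega> = indicator {\<omega> \<in> space M. idx k \<omega> = i} \<omega>" if "\<omega> \<in> space M" for i \<omega>
    using that by (simp add: X_def)
  have intX: "integrable M (X i)" for i
    using ev[of i] by (subst Bochner_Integration.integrable_cong[OF refl X]) (auto simp: integrable_indicator_iff emeasure_finite less_top[symmetric])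
  have EX: "expectation (X i) = prob {\<omega> \<in> space M. idx k \<omega> = i}" for i
    using ev[of i] by (subst Bochner_Integration.integral_cong[OF refl X]) auto
  have indXY: "indep_var borel (X i) borel (Y i)" for i
  proof -
    define H where "H B \<omega> = restrict (\<lambda>j. idx j \<omega>) B" for B \<omega>
    have "indep_var (PiM {k} (\<lambda>_. count_space UNIV)) (H {k}) (PiM {..<k} (\<lambda>_. count_space UNIV)) (H {..<k})"
      unfolding H_def by (rule indep_var_restrict[OF indep]) auto
    hence "indep_var (count_space (PiE {k} (\<lambda>_. UNIV))) (H {k}) (count_space (PiE {..<k} (\<lambda>_. UNIV))) (H {..<k})"
      by (simp add: count_space_PiM_finite)
    hence "indep_var borel ((\<lambda>h. if h k = i then 1 else 0 :: real) \<circ> H {k}) borel ((\<lambda>h. F h i) \<circ> H {..<k})"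
      by (rule indep_var_compose) auto
    moreover have "(\<lambda>h. if h k = i then 1 else 0 :: real) \<circ> H {k} = X i"
      by (auto simp: H_def X_def)
    moreover have "(\<lambda>h. F h i) \<circ> H {..<k} = Y i"
      unfolding H_def Y_def comp_def by (intro ext F) simp
    ultimately show ?thesis by simp
  qed
  have "expectation (\<lambda>\<omega>. F (\<lambda>j. idx j \<omega>) (idx k \<omega>)) = expectation (\<lambda>\<omega>. \<Sum>i\<in>UNIV. X i \<omega> * Y i \<omega>)"
    by (simp add: X_def Y_def if_distrib if_distribR cong: if_cong)
  also have "\<dots> = (\<Sum>i\<in>UNIV. expectation (\<lambda>\<omega>. X i \<omega> * Y i \<omega>))"
    by (intro Bochner_Integration.integral_sum indep_var_integrable indXY intX intY)
  also have "\<dots> = (\<Sum>i\<in>UNIV. prob {\<omega> \<in> space M. idx k \<omega> = i} * expectation (Y i))"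
    by (simp add: indep_var_lebesgue_integral[OF indXY intX intY] EX)
  finally show ?thesis unfolding Y_def .
qed

lemma (in prob_space) expectation_sq_le:
  fixes X :: "'a \<Rightarrow> real"
  assumes "integrable M X" "integrable M (\<lambda>\<omega>. (X \<omega>)\<^sup>2)"
  shows "(expectation X)\<^sup>2 \<le> expectation (\<lambda>\<omega>. (X \<omega>)\<^sup>2)"
  using variance_positive[of X] variance_eq[OF assms] by simp

section \<open>The scalar recursion\<close>

lemma quadratic_recursion_rate:
  fixes e :: "nat \<Rightarrow> real"
  assumes nonneg: "\<And>k. 0 \<le> e k" and C: "0 \<le> C" and init: "e 0 \<le> C / 4"
    and step: "\<And>k. C * e (Suc k) \<le> C * e k - (e k)\<^sup>2"
  shows "e k \<le> C / (real k + 4)"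
proof (cases "C = 0")
  case True
  have "(e k)\<^sup>2 \<le> 0" using step[of k] True by simp
  thus ?thesis using True by simp
next
  case False
  with C have C: "C > 0" by simp
  show ?thesis
  proof (induction k)
    case 0
    show ?case using init by simp
  next
    case (Suc k)
    define a where "a = C / (real k + 4)"
    have a: "0 \<le> a" "a \<le> C / 2" using C by (auto simp: a_def divide_simps)
    have "e k \<le> a" using Suc by (simp add: a_def)
    \<comment> \<open>The product is the difference of \<open>C * t - t * t\<close> between
      \<open>t = a\<close> and \<open>t = e k\<close>: this function increases up to
      \<open>C / 2\<close>, so the bound \<open>a\<close> may replace \<open>e k\<close>.\<close>
    hence "0 \<le> (a - e k) * (C - a - e k)"
      using a by (intro mult_nonneg_nonneg) auto
    hence "C * e k - (e k)\<^sup>2 \<le> C * a - a\<^sup>2" by (simp add: algebra_simps power2_eq_square)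
    also have "\<dots> \<le> C * (C / (real (Suc k) + 4))"
    proof -
      have "1 / d - (1 / d)\<^sup>2 \<le> 1 / (d + 1)" if "d > 0" for d :: real
      proof -
        have "1 / (d + 1) - (1 / d - (1 / d)\<^sup>2) = 1 / (d\<^sup>2 * (d + 1))"
          using that by (simp add: field_simps power2_eq_square)
        also have "\<dots> \<ge> 0" using that by simp
        finally show ?thesis by simp
      qed
      from this[of "real k + 4"]
      have "1 / (real k + 4) - (1 / (real k + 4))\<^sup>2 \<le> 1 / (real (Suc k) + 4)"
        by (simp add: algebra_simps)
      from mult_left_mono[OF this, of "C * C"] show ?thesis
        by (simp add: a_def algebra_simps power2_eq_square)
    qed
    finally have "C * e (Suc k) \<le> C * (C / (real (Suc k) + 4))" using step[of k] by linarith
    thus ?case by (rule mult_left_le_imp_le[OF _ C])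
  qed
qed


section \<open>The iterates for the constant parameter\<close>

context constrained_minimum
begin

lemma arbk_dual_const_Suc:
  assumes \<theta>: "\<And>j. \<theta> j = 1 / real CARD('m)"
  shows "arbk_dual f A b \<theta> x0 u (Suc k) = rbk_step (u k) (arbk_dual f A b \<theta> x0 u k)"
proof -
  define n where "n = real CARD('m)"
  have n: "n \<noteq> 0" by (simp add: n_def)
  have convex_comb: "(1 - 1 / n) *\<^sub>R g + (1 / n) *\<^sub>R g = g" for g :: "real^'n"
    by (simp flip: scaleR_add_left)
  \<comment> \<open>With equal components \<open>c = t\<close>, and since \<open>m\<close> times the
    parameter is 1, the first component becomes \<open>c + (t' - t) = t'\<close>.\<close>
  have step: "arbk_state f A b \<theta> x0 u (Suc k) = (rbk_step (u k) g, rbk_step (u k) g)"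
    if "arbk_state f A b \<theta> x0 u k = (g, g)" for k g
    using that n by (simp add: Let_def \<theta> convex_comb rbk_step_def flip: n_def)
  have "fst (arbk_state f A b \<theta> x0 u k) = snd (arbk_state f A b \<theta> x0 u k)" for k
  proof (induction k)
    case (Suc k)
    thus ?case using step[of k "fst (arbk_state f A b \<theta> x0 u k)"] by (metis fst_conv snd_conv surjective_pairing)
  qed simp
  hence "arbk_state f A b \<theta> x0 u k = (arbk_dual f A b \<theta> x0 u k, arbk_dual f A b \<theta> x0 u k)"
    unfolding arbk_dual_def by (metis surjective_pairing)
  from step[OF this] show ?thesis by (simp add: arbk_dual_def)
qed

text \<open>Iterate \<open>k\<close> reads only indices strictly below \<open>k\<close>, so it is
  independent of \<open>idx k\<close>, which drives the next step.\<close>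

lemma arbk_dual_history:
  assumes \<theta>: "\<And>j. \<theta> j = 1 / real CARD('m)" and "\<And>j. j < k \<Longrightarrow> u j = v j"
  shows "arbk_dual f A b \<theta> x0 u k = arbk_dual f A b \<theta> x0 v k"
  using assms(2) by (induction k) (simp_all add: arbk_dual_const_Suc[of \<theta>, OF \<theta>], simp add: arbk_dual_def)

text \<open>The method runs on images under the transpose, whereas \<open>R0\<close> and the
  residual bound concern a preimage, which has to be carried along.\<close>

lemma arbk_dual_in_sublevel:
  assumes \<theta>: "\<And>j. \<theta> j = 1 / real CARD('m)" and rows: "\<And>i. row i A \<noteq> 0"
  shows "\<exists>y. arbk_dual f A b \<theta> (y0 v* A) u k = y v* A \<and> gap (y v* A) \<le> gap (y0 v* A)"
proof (induction k)
  case 0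
  show ?case by (auto simp: arbk_dual_def)
next
  case (Suc k)
  then obtain y where y: "arbk_dual f A b \<theta> (y0 v* A) u k = y v* A" "gap (y v* A) \<le> gap (y0 v* A)"
    by blast
  obtain z where z: "rbk_step (u k) (y v* A) = z v* A" using rbk_step_range by blast
  have "gap (z v* A) \<le> gap (y0 v* A)"
    using gap_rbk_step_le[OF rows, of "u k" "y v* A"] y(2) z by simp
  with z show ?case by (auto simp: arbk_dual_const_Suc[of \<theta>, OF \<theta>] y(1))
qed

end

theorem mainTheorem2:
  fixes f :: "real^'n \<Rightarrow> real"
    and A :: "real^'n^'m"
    and b y0 :: "real^'m"
    and xhat :: "real^'n"
    and \<theta> :: "nat \<Rightarrow> real"
    and M :: "'w measure"
    and idx :: "nat \<Rightarrow> 'w \<Rightarrow> 'm"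
    and k :: nat
  assumes rows: "\<And>i. row i A \<noteq> 0"
    and consistent: "\<exists>x. A *v x = b"
    and f: "strongly_convex1 f"
    and xhat: "is_arg_min f (\<lambda>x. A *v x = b) xhat"
    and sampling: "row_sampling M A idx"
    and theta: "\<And>j. \<theta> j = 1 / real CARD('m)"
    and k: "k \<ge> 1"
  defines "x0 \<equiv> transpose A *v y0"
  defines "xs \<equiv> (\<lambda>\<omega>. arbk_dual f A b \<theta> x0 (\<lambda>j. idx j \<omega>) k)"
  defines "x \<equiv> (\<lambda>\<omega>. arbk_primal f A b \<theta> x0 (\<lambda>j. idx j \<omega>) k)"
  shows "1/2 * prob_space.expectation M (\<lambda>\<omega>. (norm (x \<omega> - xhat))\<^sup>2)
           \<le> prob_space.expectation M (\<lambda>\<omega>. bregman f (xs \<omega>) (x \<omega>) xhat)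
       \<and> prob_space.expectation M (\<lambda>\<omega>. bregman f (xs \<omega>) (x \<omega>) xhat)
           \<le> 2 * (frobenius_norm A)\<^sup>2 / (real k + 4) * (R0 f A b y0)\<^sup>2"
proof -
  interpret constrained_minimum f A b xhat
    using f xhat by unfold_locales (auto simp: is_arg_min_def not_less)
  interpret prob_space M using sampling by (simp add: row_sampling_def)
  have indep: "indep_vars (\<lambda>_. count_space UNIV) idx UNIV"
    and prob: "\<And>k i. prob {\<omega> \<in> space M. idx k \<omega> = i} = (norm (row i A))\<^sup>2 / (frobenius_norm A)\<^sup>2"
    using sampling by (auto simp: row_sampling_def)
  have idx: "random_variable (count_space UNIV) (idx j)" for j
    using indep unfolding indep_vars_def by blast
  define g where "g k u = arbk_dual f A b \<theta> (y0 v* A) u k" for k u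
  have g_history: "g k u = g k v" if "\<And>j. j < k \<Longrightarrow> u j = v j" for k u v
    unfolding g_def by (rule arbk_dual_history[of \<theta>, OF theta that])
  have integrable: "integrable M (\<lambda>\<omega>. h (g k (\<lambda>j. idx j \<omega>)))" for h :: "real^'n \<Rightarrow> real" and k
    by (rule integrable_history[OF idx, of k]) (metis g_history)
  define C where "C = 2 * (frobenius_norm A)\<^sup>2 * (R0 f A b y0)\<^sup>2"
  define e where "e k = expectation (\<lambda>\<omega>. gap (g k (\<lambda>j. idx j \<omega>)))" for k

  have e_step: "C * e (Suc k) \<le> C * e k - (e k)\<^sup>2" for k
  proof -
    define w where "w i = (norm (row i A))\<^sup>2 / (frobenius_norm A)\<^sup>2" for i
    have "e (Suc k) = expectation (\<lambda>\<omega>. gap (rbk_step (idx k \<omega>) (g k (\<lambda>j. idx j \<omega>))))"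
      by (simp add: e_def g_def arbk_dual_const_Suc[of \<theta>, OF theta])
    also have "\<dots> = (\<Sum>i\<in>UNIV. w i * expectation (\<lambda>\<omega>. gap (rbk_step i (g k (\<lambda>j. idx j \<omega>)))))"
      unfolding w_def prob[of k, symmetric]
      by (rule expectation_history_step[OF indep, where F = "\<lambda>u i. gap (rbk_step i (g k u))"])
        (metis g_history)
    also have "\<dots> = expectation (\<lambda>\<omega>. \<Sum>i\<in>UNIV. w i * gap (rbk_step i (g k (\<lambda>j. idx j \<omega>))))"
      using integrable[of "\<lambda>x. gap (rbk_step _ x)"] by simp
    finally have "C * e (Suc k)
        = expectation (\<lambda>\<omega>. C * (\<Sum>i\<in>UNIV. w i * gap (rbk_step i (g k (\<lambda>j. idx j \<omega>)))))"
      by simp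
    also have "\<dots> \<le> expectation (\<lambda>\<omega>. C * gap (g k (\<lambda>j. idx j \<omega>)) - (gap (g k (\<lambda>j. idx j \<omega>)))\<^sup>2)"
    proof (rule integral_mono)
      fix \<omega>
      obtain y where "g k (\<lambda>j. idx j \<omega>) = y v* A" "gap (y v* A) \<le> gap (y0 v* A)"
        using arbk_dual_in_sublevel[of \<theta>, OF theta rows] unfolding g_def by blast
      thus "C * (\<Sum>i\<in>UNIV. w i * gap (rbk_step i (g k (\<lambda>j. idx j \<omega>))))
          \<le> C * gap (g k (\<lambda>j. idx j \<omega>)) - (gap (g k (\<lambda>j. idx j \<omega>)))\<^sup>2"
        using gap_rbk_step_average[OF rows] unfolding C_def w_def by simp
    qed (fact integrable)+
    also have "\<dots> = C * e k - expectation (\<lambda>\<omega>. (gap (g k (\<lambda>j. idx j \<omega>)))\<^sup>2)"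
      unfolding e_def
      by (subst Bochner_Integration.integral_diff) (auto intro: integrable integrable[of "\<lambda>x. (gap x)\<^sup>2"])
    \<comment> \<open>Jensen's inequality for the square turns the mean of squares into the square
      of the mean and closes the scalar recursion.\<close>
    also have "\<dots> \<le> C * e k - (e k)\<^sup>2"
      unfolding e_def by (intro diff_left_mono expectation_sq_le integrable)
    finally show ?thesis .
  qed
  have "e k \<le> C / (real k + 4)"
  proof (rule quadratic_recursion_rate[of e C])
    show "0 \<le> e k" for k unfolding e_def by (intro integral_nonneg_AE) (simp add: gap_nonneg)
    show "0 \<le> C" by (simp add: C_def)
    show "e 0 \<le> C / 4"
      using gap_init[of y0] by (simp add: e_def g_def arbk_dual_def C_def prob_space)
    show "C * e (Suc k) \<le> C * e k - (e k)\<^sup>2" for k by (rule e_step)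
  qed
  moreover have "1/2 * expectation (\<lambda>\<omega>. (norm (G (g k (\<lambda>j. idx j \<omega>)) - xhat))\<^sup>2) \<le> e k"
    unfolding e_def integral_mult_right_zero[symmetric]
    by (intro integral_mono gap_ge integrable integrable[of "\<lambda>x. 1/2 * (norm (G x - xhat))\<^sup>2"])
  ultimately show ?thesis
    unfolding xs_def x_def x0_def arbk_primal_def transpose_matrix_vector
    by (simp add: e_def gap_def g_def C_def)
qed

end
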